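(* Consider the equation $$x^{(y^z)} = z^{xy}$$ in positive integers $x,y,z$. (i) Let $S$ be the set of those positive integer solutions $(x,y,z)$ such that at least one of $x$, $y$, $z$ is equal to $1$. Then $$S = \{(1,b,1) : b \in \mathbb{Z}^+\}.$$ (ii) The only solution $(x,y,z)$ in positive integers with $x \geq 2$, $y \geq 2$, $z \geq 2$ and $x = z$ is the triple $(2,2,2)$. (iii) Let $F$ be the set of positive integer solutions $(x,y,z)$ with $x \geq 2$, $y \geq 2$, $z \geq 2$ and $y = z \neq x$. Then $$F = \{(b^b,b,b) : b \in \mathbb{Z}^+,\ b \geq 2\}.$$
   Context: $\mathbb{Z}^+$ denotes the set of positive integers. The exponent $xy$ is the product of $x$ and $y$. *)

theory Defs
  imports Main
begin

definition pos_solution :: "nat \<Rightarrow> nat \<Rightarrow> nat \<Rightarrow> bool" where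
  "pos_solution x y z \<longleftrightarrow>
     x \<ge> 1 \<and> y \<ge> 1 \<and> z \<ge> 1 \<and> x ^ (y ^ z) = z ^ (x * y)"

end

theory Submission
  imports Complex_Main Defs
begin

text \<open>
  For \<open>y = z = b\<close> the equation says \<open>x ^ m = m ^ x\<close> with \<open>m = b ^ b \<ge> 4\<close>. By
  \<open>1 + k / a < exp (k / a)\<close> and \<open>exp 1 \<le> 3\<close>, the equation \<open>u ^ v = v ^ u\<close> forces \<open>u = v\<close>
  once both are at least 3. The remaining case \<open>x = 2\<close> reduces to this by squaring,
  as \<open>2 ^ m = m ^ 2\<close> gives \<open>4 ^ m = m ^ 4\<close>.
\<close>

text \<open>With \<open>b = a + k\<close>, dividing by \<open>a ^ a\<close> reduces the claim to
  \<open>(1 + k / a) ^ a < a ^ k\<close>. The left side is below \<open>exp 1 ^ k\<close>, and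
  \<open>exp 1 \<le> 3 \<le> a\<close>.\<close>

lemma power_swap_less:
  fixes a b :: nat
  assumes "3 \<le> a" "a < b"
  shows "b ^ a < a ^ b"
proof -
  obtain k where b: "b = a + k" and k: "k > 0"
    using assms(2) less_imp_add_positive by blast
  have a: "real a > 0" using assms by simp
  have "1 + real k / a < exp (real k / a)"
    using a k ln_add_one_self_less_self[of "real k / a"]
    by (metis add_pos_pos divide_pos_pos exp_less_cancel_iff exp_ln of_nat_0_less_iff zero_less_one)
  then have "(1 + real k / a) ^ a < exp (real k / a) ^ a"
    using assms by (intro power_strict_mono) auto
  also have "\<dots> = exp 1 ^ k"
    using a by (simp flip: exp_of_nat_mult)
  also have "\<dots> \<le> real a ^ k"
    using assms exp_le by (intro power_mono) auto
  finally have "real a ^ a * (1 + real k / a) ^ a < real a ^ a * real a ^ k"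
    using a by simp
  moreover have "real a ^ a * (1 + real k / a) ^ a = real b ^ a"
    using a by (simp add: b distrib_left flip: power_mult_distrib)
  ultimately have "real (b ^ a) < real (a ^ b)"
    by (simp add: b power_add)
  then show ?thesis by (simp only: of_nat_less_iff)
qed

lemma power_swap_eq_imp_eq:
  fixes a b :: nat
  assumes "a ^ b = b ^ a" "3 \<le> a" "3 \<le> b"
  shows "a = b"
  using assms power_swap_less[of a b] power_swap_less[of b a] by (cases a b rule: linorder_cases) auto

text \<open>If \<open>x = 1\<close> or \<open>z = 1\<close>, one side of the equation is 1, so the
  base on the other side is 1 too. If \<open>y = 1\<close> and \<open>z \<ge> 2\<close>, the
  equation becomes \<open>x = z ^ x\<close>, which fails because \<open>z ^ x\<close> exceeds
  \<open>x\<close>.\<close>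

lemma solution_with_one:
  fixes x y z :: nat
  assumes "pos_solution x y z" "x = 1 \<or> y = 1 \<or> z = 1"
  shows "x = 1 \<and> z = 1"
proof -
  have pos: "x \<ge> 1" "y \<ge> 1" "z \<ge> 1" and eq: "x ^ (y ^ z) = z ^ (x * y)"
    using assms(1) by (auto simp: pos_solution_def)
  consider "x = 1" | "z = 1" | "y = 1" "z \<ge> 2" using assms(2) pos by linarith
  then show ?thesis
  proof cases
    case 3
    then have "x = z ^ x" using eq by simp
    moreover have "x < z ^ x" using 3 by (intro power_gt_expt) simp
    ultimately show ?thesis by simp
  next
    case 1
    then have "z ^ y = 1" using eq by simp
    then show ?thesis using 1 pos by (auto simp only: nat_power_eq_Suc_0_iff One_nat_def)
  next
    case 2
    then have "x ^ y = 1" using eq by simp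
    then show ?thesis using 2 pos by (auto simp only: nat_power_eq_Suc_0_iff One_nat_def)
  qed
qed

text \<open>Equal bases at least 2 force equal exponents, \<open>y ^ x = x * y\<close>. Cancelling
  \<open>y\<close> leaves \<open>y ^ (x - 1) = x\<close>, where exponential growth permits only
  \<open>x = 2\<close>.\<close>

lemma solution_x_eq_z:
  fixes x y :: nat
  assumes "pos_solution x y x" "x \<ge> 2" "y \<ge> 2"
  shows "x = 2 \<and> y = 2"
proof -
  have "y ^ x = x * y"
    using assms by (auto simp: pos_solution_def)
  moreover obtain n where n: "x = Suc n" "n \<ge> 1" using assms(2) by (cases x) auto
  ultimately have "y * y ^ n = y * Suc n" by (simp only: power_Suc mult.commute)
  then have yn: "y ^ n = Suc n" using assms(3) by (simp only: mult_cancel1) simp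
  have "n = 1"
  proof (rule ccontr)
    assume "n \<noteq> 1"
    then obtain m where m: "n = Suc m" "m \<ge> 1" using n(2) by (cases n) auto
    \<comment> \<open>This gives \<open>y ^ n \<ge> 2 * (m + 1)\<close>, which exceeds
      \<open>Suc n = m + 2\<close> because \<open>m \<ge> 1\<close>.\<close>
    have "Suc m \<le> y ^ m" using assms(3) by (intro Suc_leI power_gt_expt) simp
    then have "2 * Suc m \<le> y * y ^ m" using assms(3) by (intro mult_le_mono)
    then show False using yn m by simp
  qed
  then show ?thesis using yn n by simp
qed

lemma solution_y_eq_z:
  fixes x b :: nat
  assumes "pos_solution x b b" "x \<ge> 2" "b \<ge> 2" "b \<noteq> x"
  shows "x = b ^ b"
proof -
  define m where "m = b ^ b"
  have swap: "x ^ m = m ^ x"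
    using assms(1) by (simp add: pos_solution_def m_def power_mult mult.commute)
  have "b ^ 2 \<le> m"
    unfolding m_def using assms(3) by (intro power_increasing) auto
  moreover have "2 ^ 2 \<le> b ^ 2"
    using assms(3) by (intro power_mono) auto
  ultimately have m: "4 \<le> m" by simp
  \<comment> \<open>The value 2 lies below the threshold 3 of \<open>power_swap_eq_imp_eq\<close>.
    Here it would force \<open>m = 4\<close>, whereas \<open>b \<noteq> x\<close> gives
    \<open>b \<ge> 3\<close> and hence \<open>m \<ge> 9\<close>.\<close>
  have "x \<noteq> 2"
  proof
    assume "x = 2"
    have "(4::nat) ^ m = (2 ^ m) ^ 2"
      using power_mult[of "2::nat" 2 m] power_mult[of "2::nat" m 2] by (simp add: mult.commute)
    also have "\<dots> = (m ^ 2) ^ 2" using swap \<open>x = 2\<close> by simp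
    also have "\<dots> = m ^ 4" by (simp flip: power_mult)
    finally have "m = 4" using power_swap_eq_imp_eq[of 4 m] m by simp
    have "b \<ge> 3" using assms \<open>x = 2\<close> by linarith
    then have "3 ^ 2 \<le> b ^ 2" by (intro power_mono) auto
    then show False using \<open>b ^ 2 \<le> m\<close> \<open>m = 4\<close> by simp
  qed
  then show ?thesis
    using power_swap_eq_imp_eq[OF swap] assms(2) m by (simp add: m_def)
qed

theorem theorem5:
  shows "{(x, y, z). pos_solution x y z \<and> (x = 1 \<or> y = 1 \<or> z = 1)}
           = {(1, b, 1) | b :: nat. b \<ge> 1}
       \<and> {(x, y, z). pos_solution x y z \<and> x \<ge> 2 \<and> y \<ge> 2 \<and> z \<ge> 2 \<and> x = z}
           = {(2, 2, 2)}
       \<and> {(x, y, z). pos_solution x y z \<and> x \<ge> 2 \<and> y \<ge> 2 \<and> z \<ge> 2 \<and> y = z \<and> z \<noteq> x}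
           = {(b ^ b, b, b) | b :: nat. b \<ge> 2}"
    (is "?A = ?A' \<and> ?B = ?B' \<and> ?C = ?C'")
proof (intro conjI)
  have "pos_solution 1 b 1" if "b \<ge> 1" for b
    using that by (simp add: pos_solution_def)
  then show "?A = ?A'"
    using solution_with_one by (fastforce simp: pos_solution_def)
  have "pos_solution 2 2 2" by (simp add: pos_solution_def)
  then show "?B = ?B'"
    using solution_x_eq_z by fastforce
  \<comment> \<open>For the converse inclusion, both sides of the equation equal
    \<open>b ^ (b * b ^ b)\<close>; the two remaining conditions follow from
    \<open>b < b ^ b\<close>.\<close>
  have "pos_solution (b ^ b) b b \<and> b ^ b \<ge> 2 \<and> b \<noteq> b ^ b" if "b \<ge> 2" for b :: nat
  proof -
    have "b ^ 1 < b ^ b" using that by (intro power_strict_increasing) auto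
    then show ?thesis
      using that by (simp add: pos_solution_def mult.commute flip: power_mult)
  qed
  then show "?C = ?C'"
    by (auto dest: solution_y_eq_z)
qed

end
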